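(* Let $\mathcal{P}$ be a finite pure simplicial poset of rank $k$, let $\sigma = (\sigma_1, \ldots, \sigma_m)$ be a composition of $k$, and let $\pi = (\pi_1, \ldots, \pi_m)$ be a permutation of $\sigma$ (that is, a rearrangement of its entries). If $\pi_1 \geq \sigma_1$, then $$d^{\,\sigma}(\mathcal{P}) \unrhd d^{\,\pi}(\mathcal{P}),$$ where $d^{\,\sigma}(\mathcal{P})$ and $d^{\,\pi}(\mathcal{P})$ are the face-to-flag degree sequences and $\unrhd$ denotes majorization.
   Context: A composition of $k$ is a finite sequence of positive integers with sum $k$. A simplicial poset is a poset with a minimal element $\hat{0}$ in which every principal order ideal $[\hat{0},x]$ is a boolean algebra; the rank ${\rm rk}(x)$ of $x$ is the rank of the boolean algebra $[\hat 0,x]$. It is pure of rank $k$ if every maximal element has rank $k$. Elements of the poset are called faces. For a composition $\sigma = (\sigma_1,\ldots,\sigma_m)$ of $k$ and a face $F$ of rank $\sigma_1$, let $d^{\,\sigma}(F)$ be the number of chains $F = X_1 < X_2 < \cdots < X_m$ in $\mathcal{P}$ with ${\rm rk}(X_j) = \sigma_1 + \sigma_2 + \cdots + \sigma_j$ for every $j$. The face-to-flag degree sequence is $d^{\,\sigma}(\mathcal{P}) = (d^{\,\sigma}(F_1), \ldots, d^{\,\sigma}(F_s))$, where $F_1,\ldots,F_s$ are all the rank-$\sigma_1$ faces of $\mathcal{P}$, indexed so that $d^{\,\sigma}(F_1) \ge d^{\,\sigma}(F_2) \ge \cdots \ge d^{\,\sigma}(F_s)$. For sequences of nonnegative integers $a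 = (a_1,\ldots,a_n)$ and $b=(b_1,\ldots,b_{n'})$ (possibly of different lengths) having the same sum, $a$ majorizes $b$, written $a \unrhd b$, if $a_1 + \cdots + a_r \ge b_1 + \cdots + b_r$ for all $1 \le r \le n-1$, with the convention $b_i = 0$ for $i > n'$. In particular, the assertion $a \unrhd b$ includes the equality of the total sums. *)

theory Defs
  imports "HOL-Algebra.Lattice" "HOL-Library.Multiset"
begin

locale boolean_lattice = bounded_lattice L for L (structure) +
  assumes meet_join_distrib:
      "\<lbrakk>x \<in> carrier L; y \<in> carrier L; z \<in> carrier L\<rbrakk> \<Longrightarrow>
         x \<sqinter> (y \<squnion> z) = (x \<sqinter> y) \<squnion> (x \<sqinter> z)"
    and complement_exists:
      "x \<in> carrier L \<Longrightarrow> \<exists>y \<in> carrier L. x \<sqinter> y = \<bottom> \<and> x \<squnion> y = \<top>"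

definition lower_interval :: "('a, 'b) gorder_scheme \<Rightarrow> 'a \<Rightarrow> ('a, 'b) gorder_scheme" where
  "lower_interval P x = P\<lparr>carrier := \<lbrace>\<bottom>\<^bsub>P\<^esub>..x\<rbrace>\<^bsub>P\<^esub>\<rparr>"

locale simplicial_poset = partial_order P + weak_partial_order_bottom P for P (structure) +
  assumes boolean_lower_interval:
    "x \<in> carrier P \<Longrightarrow> boolean_lattice (lower_interval P x)"

text \<open>
  The rank of a finite Boolean algebra, as a graded poset, is the length of a longest chain in it,
  where a chain with \<open>n + 1\<close> elements has length \<open>n\<close>.
\<close>

definition chain_rank :: "('a, 'b) gorder_scheme \<Rightarrow> nat" where
  "chain_rank P = Max {card C - 1 | C. C \<subseteq> carrier P \<and> finite C \<and> C \<noteq> {} \<and>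
     (\<forall>x\<in>C. \<forall>y\<in>C. x \<sqsubseteq>\<^bsub>P\<^esub> y \<or> y \<sqsubseteq>\<^bsub>P\<^esub> x)}"

definition rk :: "('a, 'b) gorder_scheme \<Rightarrow> 'a \<Rightarrow> nat" where
  "rk P x = chain_rank (lower_interval P x)"

definition pure_of_rank :: "('a, 'b) gorder_scheme \<Rightarrow> nat \<Rightarrow> bool" where
  "pure_of_rank P k \<longleftrightarrow>
     (\<forall>x \<in> carrier P. (\<forall>y \<in> carrier P. x \<sqsubseteq>\<^bsub>P\<^esub> y \<longrightarrow> y = x) \<longrightarrow> rk P x = k)"

definition composition :: "nat \<Rightarrow> nat list \<Rightarrow> bool" where
  "composition k \<sigma> \<longleftrightarrow> (\<forall>s \<in> set \<sigma>. 0 < s) \<and> sum_list \<sigma> = k"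

text \<open>
  The entry \<open>\<sigma>\<^sub>1\<close> is \<open>hd \<sigma>\<close>, so the next two definitions are meaningful for
  nonempty \<open>\<sigma>\<close> only. A chain \<open>X\<^sub>1 < \<dots> < X\<^sub>m\<close> is the list \<open>X\<close> with
  \<open>X\<^sub>j = X ! (j - 1)\<close>.
\<close>

definition flag_degree :: "('a, 'b) gorder_scheme \<Rightarrow> nat list \<Rightarrow> 'a \<Rightarrow> nat" where
  "flag_degree P \<sigma> F = card {X. length X = length \<sigma> \<and> set X \<subseteq> carrier P \<and>
     hd X = F \<and> sorted_wrt (\<lambda>x y. x \<sqsubset>\<^bsub>P\<^esub> y) X \<and>
     (\<forall>j < length \<sigma>. rk P (X ! j) = sum_list (take (Suc j) \<sigma>))}"

definition flag_degree_seq :: "('a, 'b) gorder_scheme \<Rightarrow> nat list \<Rightarrow> nat list" where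
  "flag_degree_seq P \<sigma> = rev (sorted_list_of_multiset
     (image_mset (flag_degree P \<sigma>) (mset_set {F \<in> carrier P. rk P F = hd \<sigma>})))"

text \<open>
  Since \<open>take r b = b\<close> for \<open>r \<ge> length b\<close>, the sequence \<open>b\<close> is implicitly padded with zeros.
\<close>

definition majorizes :: "nat list \<Rightarrow> nat list \<Rightarrow> bool"  (infix \<open>\<unrhd>\<close> 50) where
  "a \<unrhd> b \<longleftrightarrow> sum_list a = sum_list b \<and>
     (\<forall>r. 1 \<le> r \<and> r \<le> length a - 1 \<longrightarrow> sum_list (take r b) \<le> sum_list (take r a))"

end

theory Submission
  imports Defs Complex_Main
begin

text \<open>
  Write \<open>f(F)\<close> for the number of rank-\<open>k\<close> faces above \<open>F\<close>, and let \<open>s = \<sigma>\<^sub>1\<close>,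
  \<open>t = \<pi>\<^sub>1\<close>. Since every interval below a face is a finite Boolean algebra, counting flags
  one step at a time (\<open>card_chains_from\<close>) gives \<open>d\<^sup>\<sigma>(F) = M\<^sub>\<sigma> f(F)\<close>, where \<open>M\<^sub>\<sigma>\<close> is the
  multinomial coefficient of \<open>(\<sigma>\<^sub>2, \<dots>, \<sigma>\<^sub>m)\<close>. The product of \<open>M\<^sub>\<sigma>\<close> and
  \<open>k choose s\<close> is the multinomial coefficient of the whole of \<open>\<sigma>\<close>, which only depends on
  the multiset of entries. Hence the two total sums agree, and the claim on partial sums becomes:
  the sum of the \<open>r\<close> largest values of \<open>f / (k choose s)\<close> on rank-\<open>s\<close> faces is at least the
  sum of the \<open>r\<close> largest values of \<open>f / (k choose t)\<close> on rank-\<open>t\<close> faces.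

  A sum of the \<open>r\<close> largest values of a nonnegative function dominates every weighted sum with weights
  in \<open>[0, 1]\<close> of total at most \<open>r\<close> (\<open>weighted_sum_le_top_sum\<close>). So let \<open>S\<close> be a set of at
  most \<open>r\<close> rank-\<open>t\<close> faces on which \<open>f\<close> is largest, and give each rank-\<open>s\<close> face \<open>F\<close> the weight
  \<open>x(F) = min 1 (d(F) / (t choose s))\<close>, where \<open>d(F)\<close> is the number of members of \<open>S\<close> above
  \<open>F\<close>. As each member of \<open>S\<close> contains \<open>t choose s\<close> faces of rank \<open>s\<close>, the total weight is
  at most \<open>card S\<close>. It remains to compare the two weighted sums of \<open>f\<close>, and by exchanging
  summations this may be done separately for each face \<open>H\<close> of rank \<open>k\<close>
  (\<open>fractional_shadow\<close>). Let \<open>c = (k choose s) / (k choose t)\<close>. Below \<open>H\<close>, a rank-\<open>s\<close>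
  face lies under at most
  \<open>(k - s) choose (t - s) = (t choose s) / c\<close> members of \<open>S\<close>; if \<open>c \<le> 1\<close>, the truncated weight
  is therefore still at least \<open>c\<close> times the untruncated weight coming from the members of \<open>S\<close>
  below \<open>H\<close>, and summing over the rank-\<open>s\<close> faces below \<open>H\<close> gives the inequality. Finally,
  \<open>c \<le> 1\<close> holds because either \<open>s = t\<close>, or \<open>s\<close> and \<open>t\<close> are entries of \<open>\<sigma>\<close> at different
  positions, so that \<open>s \<le> t \<le> k - s\<close>.
\<close>

section \<open>Finite Boolean lattices\<close>

text \<open>
  The atoms of \<open>P\<close> lying below \<open>x\<close>. In a simplicial poset the set does not change when
  \<open>P\<close> is replaced by an interval \<open>[\<bottom>, z]\<close> with \<open>x \<le> z\<close>, so the atoms of all these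
  Boolean algebras can be compared with each other.
\<close>

definition atoms_below :: "('a, 'b) gorder_scheme \<Rightarrow> 'a \<Rightarrow> 'a set" where
  "atoms_below P x = {a \<in> carrier P. a \<noteq> \<bottom>\<^bsub>P\<^esub> \<and> a \<sqsubseteq>\<^bsub>P\<^esub> x \<and>
     (\<forall>y \<in> carrier P. y \<sqsubseteq>\<^bsub>P\<^esub> a \<longrightarrow> y = \<bottom>\<^bsub>P\<^esub> \<or> y = a)}"

lemma (in partial_order) finite_has_minimal_below:
  assumes "finite A" "A \<subseteq> carrier L" "x \<in> A"
  shows "\<exists>m \<in> A. m \<sqsubseteq> x \<and> (\<forall>y \<in> A. y \<sqsubseteq> m \<longrightarrow> y = m)"
  using assms
proof (induction "card {y \<in> A. y \<sqsubseteq> x}" arbitrary: x rule: less_induct)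
  case less
  show ?case
  proof (cases "\<forall>y \<in> A. y \<sqsubseteq> x \<longrightarrow> y = x")
    case True
    then show ?thesis using less.prems by blast
  next
    case False
    then obtain y where y: "y \<in> A" "y \<sqsubseteq> x" "y \<noteq> x" by blast
    have "z \<sqsubseteq> x" if "z \<in> A" "z \<sqsubseteq> y" for z
      using le_trans[OF that(2) y(2)] that(1) y(1) less.prems by auto
    then have "{z \<in> A. z \<sqsubseteq> y} \<subseteq> {z \<in> A. z \<sqsubseteq> x}" by blast
    moreover have "x \<notin> {z \<in> A. z \<sqsubseteq> y}"
      using less.prems y le_antisym[of x y] by blast
    moreover have "x \<in> {z \<in> A. z \<sqsubseteq> x}" using less.prems by blast
    ultimately have "card {z \<in> A. z \<sqsubseteq> y} < card {z \<in> A. z \<sqsubseteq> x}"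
      using less.prems(1) by (intro psubset_card_mono) auto
    from less.hyps[OF this less.prems(1,2) y(1)]
    obtain m where "m \<in> A" "m \<sqsubseteq> y" "\<forall>z \<in> A. z \<sqsubseteq> m \<longrightarrow> z = m" by blast
    moreover from this have "m \<sqsubseteq> x"
      using y less.prems le_trans[of m y x] by blast
    ultimately show ?thesis by blast
  qed
qed

context boolean_lattice
begin

lemma exists_atom_below:
  assumes "finite (carrier L)" "x \<in> carrier L" "x \<noteq> \<bottom>"
  shows "\<exists>a. a \<in> atoms_below L x"
proof -
  from finite_has_minimal_below[of "carrier L - {\<bottom>}" x] assms
  obtain m where "m \<in> carrier L - {\<bottom>}" "m \<sqsubseteq> x"
    "\<forall>y \<in> carrier L - {\<bottom>}. y \<sqsubseteq> m \<longrightarrow> y = m" by auto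
  then have "m \<in> atoms_below L x" by (auto simp: atoms_below_def)
  then show ?thesis ..
qed

lemma atoms_below_bottom: "atoms_below L \<bottom> = {}"
proof -
  have "a = \<bottom>" if "a \<in> carrier L" "a \<sqsubseteq> \<bottom>" for a
    using that le_antisym[of a \<bottom>] by simp
  then show ?thesis by (auto simp: atoms_below_def)
qed

lemma le_iff_atoms_below_subset:
  assumes fin: "finite (carrier L)" and x: "x \<in> carrier L" and y: "y \<in> carrier L"
  shows "x \<sqsubseteq> y \<longleftrightarrow> atoms_below L x \<subseteq> atoms_below L y"
proof
  assume "x \<sqsubseteq> y"
  then show "atoms_below L x \<subseteq> atoms_below L y"
    using x y by (auto simp: atoms_below_def intro: le_trans)
next
  assume sub: "atoms_below L x \<subseteq> atoms_below L y"
  show "x \<sqsubseteq> y"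
  proof (rule ccontr)
    assume nle: "\<not> x \<sqsubseteq> y"
    obtain y' where y': "y' \<in> carrier L" "y \<sqinter> y' = \<bottom>" "y \<squnion> y' = \<top>"
      using complement_exists[OF y] by blast
    \<comment> \<open>An atom below \<open>x\<close> and below the complement of \<open>y\<close> cannot lie below \<open>y\<close>.\<close>
    have "x \<sqinter> y' \<noteq> \<bottom>"
    proof
      assume bot: "x \<sqinter> y' = \<bottom>"
      have "x = x \<sqinter> \<top>" using le_iff_join[of x \<top>] x by simp
      also have "\<dots> = (x \<sqinter> y) \<squnion> (x \<sqinter> y')"
        using meet_join_distrib[OF x y y'(1)] y'(3) by simp
      also have "\<dots> = x \<sqinter> y"
        using bottom_join[of "x \<sqinter> y"] x y bot by (simp add: join_comm eq_is_equal)
      finally show False using nle le_iff_join[OF x y] by simp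
    qed
    then obtain a where a: "a \<in> atoms_below L (x \<sqinter> y')"
      using exists_atom_below[OF fin] x y'(1) by (metis meet_closed)
    then have aL: "a \<in> carrier L" "a \<noteq> \<bottom>" "a \<sqsubseteq> x \<sqinter> y'"
      by (auto simp: atoms_below_def)
    have ax: "a \<sqsubseteq> x" and ay': "a \<sqsubseteq> y'"
      using aL x y'(1) le_trans[OF aL(3) meet_left] le_trans[OF aL(3) meet_right] by auto
    have "a \<in> atoms_below L x" using a ax by (simp add: atoms_below_def)
    then have "a \<sqsubseteq> y" using sub by (auto simp: atoms_below_def)
    then have "a \<sqsubseteq> y \<sqinter> y'" using ay' aL(1) y y'(1) by (intro meet_le) auto
    then have "a = \<bottom>" using y'(2) aL(1) le_antisym[of a \<bottom>] by simp
    with aL(2) show False ..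
  qed
qed

lemma exists_join_of_atoms:
  assumes fin: "finite (carrier L)" and "finite B" "B \<subseteq> atoms_below L \<top>"
  shows "\<exists>x \<in> carrier L. atoms_below L x = B"
  using assms(2,3)
proof (induction B rule: finite_induct)
  case empty
  then show ?case using atoms_below_bottom by blast
next
  case (insert a B)
  then obtain x where x: "x \<in> carrier L" "atoms_below L x = B" by blast
  from insert have aL: "a \<in> carrier L" "a \<noteq> \<bottom>"
    and amin: "\<And>y. y \<in> carrier L \<Longrightarrow> y \<sqsubseteq> a \<Longrightarrow> y = \<bottom> \<or> y = a"
    by (auto simp: atoms_below_def)
  have "atoms_below L (x \<squnion> a) = insert a B"
  proof
    have "a \<in> atoms_below L (x \<squnion> a)"
      using aL amin join_right[OF x(1) aL(1)] by (auto simp: atoms_below_def)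
    moreover have "B \<subseteq> atoms_below L (x \<squnion> a)"
      using le_iff_atoms_below_subset[OF fin x(1), of "x \<squnion> a"] join_left[OF x(1) aL(1)] x aL(1)
      by simp
    ultimately show "insert a B \<subseteq> atoms_below L (x \<squnion> a)" by blast
    show "atoms_below L (x \<squnion> a) \<subseteq> insert a B"
    proof
      fix b assume "b \<in> atoms_below L (x \<squnion> a)"
      then have bL: "b \<in> carrier L" "b \<noteq> \<bottom>" "b \<sqsubseteq> x \<squnion> a"
        and bmin: "\<And>y. y \<in> carrier L \<Longrightarrow> y \<sqsubseteq> b \<Longrightarrow> y = \<bottom> \<or> y = b"
        by (auto simp: atoms_below_def)
      show "b \<in> insert a B"
      proof (cases "b \<sqsubseteq> x")
        case True
        then show ?thesis using bL bmin x(2) by (auto simp: atoms_below_def)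
      next
        case False
        have "b \<sqinter> x = \<bottom>"
          using bmin[of "b \<sqinter> x"] False bL(1) x(1) le_iff_join[of b x] by (metis meet_closed meet_left)
        moreover have "b = b \<sqinter> (x \<squnion> a)"
          using bL x(1) aL(1) le_iff_join[of b "x \<squnion> a"] by simp
        ultimately have "b = \<bottom> \<squnion> (b \<sqinter> a)"
          using meet_join_distrib[of b x a] bL(1) x(1) aL(1) by simp
        then have "b = b \<sqinter> a"
          using bottom_join[of "b \<sqinter> a"] bL(1) aL(1) by (simp add: eq_is_equal)
        then have "b \<sqsubseteq> a" using le_iff_join bL(1) aL(1) by blast
        then show ?thesis using amin[OF bL(1)] bL(2) by blast
      qed
    qed
  qed
  then show ?case using x(1) aL(1) by (intro bexI[of _ "x \<squnion> a"]) simp_all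
qed

lemma atoms_below_inj:
  assumes "finite (carrier L)" "x \<in> carrier L" "y \<in> carrier L" "atoms_below L x = atoms_below L y"
  shows "x = y"
  using assms le_iff_atoms_below_subset[of x y] le_iff_atoms_below_subset[of y x] le_antisym by simp

text \<open>
  A finite Boolean lattice is the power set of its set of atoms; by
  \<open>le_iff_atoms_below_subset\<close> the bijection respects the orders.
\<close>

lemma bij_betw_atoms_below:
  assumes fin: "finite (carrier L)"
  shows "bij_betw (atoms_below L) (carrier L) (Pow (atoms_below L \<top>))"
proof -
  have finA: "finite (atoms_below L \<top>)"
    by (rule finite_subset[OF _ fin]) (auto simp: atoms_below_def)
  have "atoms_below L ` carrier L = Pow (atoms_below L \<top>)"
  proof
    show "atoms_below L ` carrier L \<subseteq> Pow (atoms_below L \<top>)"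
      using le_iff_atoms_below_subset[OF fin] by (metis PowI image_subsetI top_closed top_higher)
    show "Pow (atoms_below L \<top>) \<subseteq> atoms_below L ` carrier L"
      using exists_join_of_atoms[OF fin] finA by (metis PowD finite_subset image_eqI subsetI)
  qed
  then show ?thesis
    using atoms_below_inj[OF fin] by (auto simp: bij_betw_def inj_on_def)
qed

lemma chain_rank_eq_card_atoms:
  assumes fin: "finite (carrier L)"
  shows "chain_rank L = card (atoms_below L \<top>)"
proof -
  let ?n = "card (atoms_below L \<top>)"
  let ?chain = "\<lambda>C. C \<subseteq> carrier L \<and> finite C \<and> C \<noteq> {} \<and> (\<forall>x\<in>C. \<forall>y\<in>C. x \<sqsubseteq> y \<or> y \<sqsubseteq> x)"
  note bij = bij_betw_atoms_below[OF fin]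
  have finA: "finite (atoms_below L \<top>)"
    by (rule finite_subset[OF _ fin]) (auto simp: atoms_below_def)
  have below: "atoms_below L x \<subseteq> atoms_below L \<top>" if "x \<in> carrier L" for x
    using bij_betwE[OF bij] that by blast
  have upper: "card C - 1 \<le> ?n" if C: "?chain C" for C
  proof -
    let ?f = "\<lambda>x. card (atoms_below L x)"
    have "inj_on ?f C"
    proof (rule inj_onI)
      fix x y assume xy: "x \<in> C" "y \<in> C" "?f x = ?f y"
      then have L: "x \<in> carrier L" "y \<in> carrier L" using C by auto
      have "atoms_below L x \<subseteq> atoms_below L y \<or> atoms_below L y \<subseteq> atoms_below L x"
        using C xy L le_iff_atoms_below_subset[OF fin] by blast
      then have "atoms_below L x = atoms_below L y"
        using xy(3) below[OF L(1)] below[OF L(2)] finA by (metis card_subset_eq finite_subset)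
      then show "x = y" using atoms_below_inj[OF fin] L by blast
    qed
    then have "card C = card (?f ` C)" by (simp add: card_image)
    also have "\<dots> \<le> card {..?n}"
      using C by (intro card_mono) (auto intro!: card_mono finA dest: below)
    finally show ?thesis by simp
  qed
  have attained: "\<exists>C. ?chain C \<and> card C - 1 = ?n"
  proof -
    \<comment> \<open>A longest chain arises by adding the atoms one at a time.\<close>
    obtain as where as: "set as = atoms_below L \<top>" "distinct as"
      using finite_distinct_list[OF finA] by blast
    then have len: "length as = ?n" using distinct_card by metis
    have "\<forall>i. \<exists>x. x \<in> carrier L \<and> atoms_below L x = set (take i as)"
      using exists_join_of_atoms[OF fin] as(1) by (metis List.finite_set set_take_subset)
    then obtain e where e: "\<And>i. e i \<in> carrier L" "\<And>i. atoms_below L (e i) = set (take i as)"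
      by metis
    have "inj_on e {..?n}"
    proof (rule inj_onI)
      fix i j assume ij: "i \<in> {..?n}" "j \<in> {..?n}" "e i = e j"
      then have "card (set (take i as)) = card (set (take j as))" using e(2) by metis
      then show "i = j" using ij as(2) len by (simp add: distinct_card)
    qed
    then have "card (e ` {..?n}) = Suc ?n" by (simp add: card_image)
    moreover have "e i \<sqsubseteq> e j \<or> e j \<sqsubseteq> e i" for i j
      using e le_iff_atoms_below_subset[OF fin] set_take_subset_set_take nat_le_linear by metis
    ultimately show ?thesis using e(1) by (intro exI[of _ "e ` {..?n}"]) auto
  qed
  let ?R = "{card C - 1 | C. ?chain C}"
  have "finite ?R"
    by (rule finite_subset[of _ "{..?n}"]) (use upper in auto)
  moreover obtain C where "?chain C" "card C - 1 = ?n" using attained by blast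
  then have "?n \<in> ?R" by (intro CollectI exI[of _ C]) simp
  ultimately have "Max ?R = ?n"
    using upper by (intro Max_eqI) auto
  then show ?thesis by (simp add: chain_rank_def)
qed

end

section \<open>Intervals in simplicial posets\<close>

lemma card_subsets_between:
  assumes "finite B" "A \<subseteq> B" "card A \<le> m"
  shows "card {X. A \<subseteq> X \<and> X \<subseteq> B \<and> card X = m} = (card B - card A) choose (m - card A)"
    (is "card ?L = _")
proof -
  have finA: "finite A" using assms finite_subset by blast
  let ?R = "{Y. Y \<subseteq> B - A \<and> card Y = m - card A}"
  have "bij_betw (\<lambda>X. X - A) ?L ?R"
  proof (rule bij_betw_byWitness[where f' = "\<lambda>Y. A \<union> Y"])
    show "\<forall>X \<in> ?L. A \<union> (X - A) = X" "\<forall>Y \<in> ?R. A \<union> Y - A = Y" by auto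
    show "(\<lambda>X. X - A) ` ?L \<subseteq> ?R" using finA by (auto simp: card_Diff_subset)
    have "card (A \<union> Y) = m" if Y: "Y \<subseteq> B - A" "card Y = m - card A" for Y
    proof -
      have "finite Y" by (rule finite_subset[OF Y(1)]) (simp add: assms(1))
      then have "card (A \<union> Y) = card A + card Y"
        using finA Y(1) by (intro card_Un_disjoint) auto
      then show ?thesis using Y(2) assms(3) by simp
    qed
    then show "(\<lambda>Y. A \<union> Y) ` ?R \<subseteq> ?L" using assms(2) by blast
  qed
  then have "card ?L = card ?R" by (rule bij_betw_same_card)
  also have "\<dots> = card (B - A) choose (m - card A)" using assms(1) by (intro n_subsets) simp
  also have "card (B - A) = card B - card A" using finA assms(2) by (intro card_Diff_subset)
  finally show ?thesis .
qed

context simplicial_poset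
begin

lemma carrier_lower_interval: "carrier (lower_interval P z) = {y \<in> carrier P. y \<sqsubseteq> z}"
  by (auto simp: lower_interval_def at_least_at_most_def)

lemma le_lower_interval: "(\<sqsubseteq>\<^bsub>lower_interval P z\<^esub>) = (\<sqsubseteq>)"
  by (simp add: lower_interval_def)

lemma bottom_lower_interval:
  assumes z: "z \<in> carrier P"
  shows "\<bottom>\<^bsub>lower_interval P z\<^esub> = \<bottom>"
proof -
  interpret I: boolean_lattice "lower_interval P z" by (rule boolean_lower_interval[OF z])
  show ?thesis
    using I.bottom_closed I.bottom_lower[of \<bottom>] z le_antisym
    by (simp add: carrier_lower_interval le_lower_interval)
qed

lemma top_lower_interval:
  assumes z: "z \<in> carrier P"
  shows "\<top>\<^bsub>lower_interval P z\<^esub> = z"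
proof -
  interpret I: boolean_lattice "lower_interval P z" by (rule boolean_lower_interval[OF z])
  show ?thesis
    using I.top_closed I.top_higher[of z] z le_antisym
    by (simp add: carrier_lower_interval le_lower_interval)
qed

lemma atoms_below_lower_interval:
  assumes z: "z \<in> carrier P" and x: "x \<in> carrier P" "x \<sqsubseteq> z"
  shows "atoms_below (lower_interval P z) x = atoms_below P x"
proof -
  have below: "a \<sqsubseteq> z" if "a \<in> carrier P" "a \<sqsubseteq> y" "y \<in> carrier P" "y \<sqsubseteq> z" for a y
    using le_trans[OF that(2,4)] that z by blast
  show ?thesis
    using below[OF _ _ x] below
    by (auto simp: atoms_below_def carrier_lower_interval le_lower_interval
        bottom_lower_interval[OF z])
qed

end

locale finite_simplicial_poset = simplicial_poset P for P (structure) +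
  assumes finite_carrier: "finite (carrier P)"
begin

lemma finite_lower_interval: "finite (carrier (lower_interval P z))"
  using finite_carrier by (simp add: carrier_lower_interval)

lemma finite_atoms_below: "finite (atoms_below P z)"
  by (rule finite_subset[OF _ finite_carrier]) (auto simp: atoms_below_def)

lemma rk_eq_card_atoms_below:
  assumes "z \<in> carrier P"
  shows "rk P z = card (atoms_below P z)"
  using boolean_lattice.chain_rank_eq_card_atoms[OF boolean_lower_interval finite_lower_interval, OF assms]
  by (simp add: rk_def top_lower_interval atoms_below_lower_interval assms)

lemma le_iff_subset_below:
  assumes "z \<in> carrier P" "x \<in> carrier P" "x \<sqsubseteq> z" "y \<in> carrier P" "y \<sqsubseteq> z"
  shows "x \<sqsubseteq> y \<longleftrightarrow> atoms_below P x \<subseteq> atoms_below P y"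
  using boolean_lattice.le_iff_atoms_below_subset[OF boolean_lower_interval finite_lower_interval, of z x y]
    assms
  by (simp add: carrier_lower_interval le_lower_interval atoms_below_lower_interval)

lemma bij_betw_interval:
  assumes z: "z \<in> carrier P"
  shows "bij_betw (atoms_below P) {y \<in> carrier P. y \<sqsubseteq> z} (Pow (atoms_below P z))"
  using boolean_lattice.bij_betw_atoms_below[OF boolean_lower_interval finite_lower_interval, OF z]
  by (subst bij_betw_cong[of _ _ "atoms_below (lower_interval P z)"])
    (auto simp: carrier_lower_interval atoms_below_lower_interval top_lower_interval z)

lemma atoms_below_mono:
  assumes "x \<in> carrier P" "y \<in> carrier P" "x \<sqsubseteq> y"
  shows "atoms_below P x \<subseteq> atoms_below P y"
  using le_iff_subset_below[of y x y] assms by simp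

lemma eq_if_le_rk_eq:
  assumes "x \<in> carrier P" "y \<in> carrier P" "x \<sqsubseteq> y" "rk P x = rk P y"
  shows "x = y"
proof -
  have "atoms_below P x = atoms_below P y"
    using assms atoms_below_mono by (intro card_subset_eq finite_atoms_below) (simp_all add: rk_eq_card_atoms_below)
  then have "y \<sqsubseteq> x" using assms le_iff_subset_below[of y y x] by simp
  then show ?thesis using assms le_antisym by simp
qed

lemma rk_bottom: "rk P \<bottom> = 0"
proof -
  have "a = \<bottom>" if "a \<in> carrier P" "a \<sqsubseteq> \<bottom>" for a
    using that le_antisym[of a \<bottom>] by simp
  then have "atoms_below P \<bottom> = {}" by (auto simp: atoms_below_def)
  then show ?thesis by (simp add: rk_eq_card_atoms_below)
qed

text \<open>
  All binomial coefficients in the argument come from this count: under the identification with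
  sets of atoms, the faces between \<open>F\<close> and \<open>H\<close> of rank \<open>m\<close> are the \<open>m\<close>-element sets
  between those of \<open>F\<close> and \<open>H\<close>.
\<close>

lemma card_interval_rank:
  assumes F: "F \<in> carrier P" and H: "H \<in> carrier P" and FH: "F \<sqsubseteq> H" and m: "rk P F \<le> m"
  shows "card {G \<in> carrier P. F \<sqsubseteq> G \<and> G \<sqsubseteq> H \<and> rk P G = m}
    = (rk P H - rk P F) choose (m - rk P F)"
proof -
  let ?A = "atoms_below P"
  note bij = bij_betw_interval[OF H]
  have sub: "?A F \<subseteq> ?A H" by (rule atoms_below_mono[OF F H FH])
  let ?I = "{G \<in> carrier P. F \<sqsubseteq> G \<and> G \<sqsubseteq> H \<and> rk P G = m}"
  have img: "?A ` ?I = {B. ?A F \<subseteq> B \<and> B \<subseteq> ?A H \<and> card B = m}"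
  proof (intro equalityI subsetI)
    fix B assume "B \<in> ?A ` ?I"
    then obtain G where G: "G \<in> carrier P" "F \<sqsubseteq> G" "G \<sqsubseteq> H" "rk P G = m" and B: "B = ?A G" by blast
    then show "B \<in> {B. ?A F \<subseteq> B \<and> B \<subseteq> ?A H \<and> card B = m}"
      using atoms_below_mono[OF F G(1,2)] atoms_below_mono[OF G(1) H G(3)] rk_eq_card_atoms_below[of G]
      by simp
  next
    fix B assume B: "B \<in> {B. ?A F \<subseteq> B \<and> B \<subseteq> ?A H \<and> card B = m}"
    then have "B \<in> ?A ` {y \<in> carrier P. y \<sqsubseteq> H}"
      by (simp add: bij_betw_imp_surj_on[OF bij])
    then obtain G where G: "G \<in> carrier P" "G \<sqsubseteq> H" "B = ?A G" by blast
    moreover have "F \<sqsubseteq> G" "rk P G = m"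
      using B G le_iff_subset_below[OF H F FH G(1,2)] rk_eq_card_atoms_below[of G] by simp_all
    ultimately show "B \<in> ?A ` ?I" by simp
  qed
  have "inj_on ?A ?I"
    by (rule inj_on_subset[OF bij_betw_imp_inj_on[OF bij]]) auto
  then have "card ?I = card (?A ` ?I)" by (simp add: card_image)
  also have "\<dots> = card {B. ?A F \<subseteq> B \<and> B \<subseteq> ?A H \<and> card B = m}" unfolding img ..
  also have "\<dots> = (card (?A H) - card (?A F)) choose (m - card (?A F))"
    using m rk_eq_card_atoms_below[OF F] by (intro card_subsets_between[OF finite_atoms_below sub]) simp
  finally show ?thesis unfolding rk_eq_card_atoms_below[OF F] rk_eq_card_atoms_below[OF H] .
qed

lemma card_rank_below:
  assumes "H \<in> carrier P"
  shows "card {G \<in> carrier P. G \<sqsubseteq> H \<and> rk P G = m} = rk P H choose m"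
proof -
  have "{G \<in> carrier P. G \<sqsubseteq> H \<and> rk P G = m} = {G \<in> carrier P. \<bottom> \<sqsubseteq> G \<and> G \<sqsubseteq> H \<and> rk P G = m}"
    by auto
  then show ?thesis using card_interval_rank[of \<bottom> H m] assms by (simp add: rk_bottom)
qed

end

section \<open>Flags and multinomial coefficients\<close>

text \<open>
  The multinomial coefficient \<open>(\<tau>\<^sub>1 + \<dots> + \<tau>\<^sub>m)! / (\<tau>\<^sub>1! \<dots> \<tau>\<^sub>m!)\<close>,
  built up one binomial coefficient at a time.
\<close>

fun multinomial :: "nat list \<Rightarrow> nat" where
  "multinomial [] = 1"
| "multinomial (a # \<tau>) = (a + sum_list \<tau> choose a) * multinomial \<tau>"

lemma multinomial_fact: "multinomial \<tau> * prod_list (map fact \<tau>) = fact (sum_list \<tau>)"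
proof (induction \<tau>)
  case (Cons a \<tau>)
  have "multinomial (a # \<tau>) * prod_list (map fact (a # \<tau>))
      = fact a * (multinomial \<tau> * prod_list (map fact \<tau>)) * (a + sum_list \<tau> choose a)"
    by (simp add: ac_simps)
  also have "\<dots> = fact (a + sum_list \<tau>)"
    using binomial_fact_lemma[of a "a + sum_list \<tau>"] unfolding Cons.IH by simp
  finally show ?case by simp
qed simp

lemma multinomial_mset_cong:
  assumes "mset \<sigma> = mset \<tau>"
  shows "multinomial \<sigma> = multinomial \<tau>"
proof -
  have "mset (map fact \<sigma>) = (mset (map fact \<tau>) :: nat multiset)" using assms by simp
  then have "prod_list (map fact \<sigma>) = (prod_list (map fact \<tau>) :: nat)"
    by (metis prod_mset_prod_list)
  moreover have "sum_list \<sigma> = sum_list \<tau>" using assms by (metis sum_mset_sum_list)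
  moreover have "prod_list (map fact \<tau>) \<noteq> (0 :: nat)" by (induction \<tau>) auto
  ultimately show ?thesis
    using multinomial_fact[of \<sigma>] multinomial_fact[of \<tau>] by (metis mult_right_cancel)
qed

lemma sum_card_swap:
  assumes "finite A" "finite B"
  shows "(\<Sum>x\<in>A. card {y \<in> B. R x y}) = (\<Sum>y\<in>B. card {x \<in> A. R x y})"
  using sum.swap_restrict[OF assms, of "\<lambda>_ _. 1::nat" R] by simp

definition faces :: "('a, 'b) gorder_scheme \<Rightarrow> nat \<Rightarrow> 'a set" where
  "faces P n = {F \<in> carrier P. rk P F = n}"

text \<open>
  The number of rank-\<open>k\<close> faces containing \<open>F\<close>.
\<close>

definition face_degree :: "('a, 'b) gorder_scheme \<Rightarrow> nat \<Rightarrow> 'a \<Rightarrow> nat" where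
  "face_degree P k F = card {H \<in> faces P k. F \<sqsubseteq>\<^bsub>P\<^esub> H}"

text \<open>
  The chains \<open>F < X\<^sub>1 < \<dots> < X\<^sub>m\<close> whose successive rank differences are the entries of
  \<open>\<tau>\<close>. The initial face \<open>F\<close> is not part of the list, so for \<open>\<tau> = []\<close> there is exactly one
  chain, the empty list.
\<close>

definition chains_from :: "('a, 'b) gorder_scheme \<Rightarrow> nat list \<Rightarrow> 'a \<Rightarrow> 'a list set" where
  "chains_from P \<tau> F = {X. length X = length \<tau> \<and> set X \<subseteq> carrier P \<and>
     sorted_wrt (\<lambda>x y. x \<sqsubset>\<^bsub>P\<^esub> y) (F # X) \<and>
     (\<forall>j < length \<tau>. rk P (X ! j) = rk P F + sum_list (take (Suc j) \<tau>))}"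

context finite_simplicial_poset
begin

lemma finite_faces: "finite (faces P n)"
  by (rule finite_subset[OF _ finite_carrier]) (auto simp: faces_def)

text \<open>
  Double counting of the pairs \<open>G \<le> H\<close> above \<open>F\<close> with \<open>G\<close> of rank \<open>rk F + a\<close> and \<open>H\<close> of
  rank \<open>k\<close>.
\<close>

lemma sum_face_degree:
  assumes F: "F \<in> carrier P" and a: "rk P F + a \<le> k"
  shows "(\<Sum>G \<in> {G \<in> faces P (rk P F + a). F \<sqsubseteq> G}. face_degree P k G)
    = ((k - rk P F) choose a) * face_degree P k F"
proof -
  let ?A = "{G \<in> faces P (rk P F + a). F \<sqsubseteq> G}" and ?B = "{H \<in> faces P k. F \<sqsubseteq> H}"
  have "{H \<in> faces P k. G \<sqsubseteq> H} = {H \<in> ?B. G \<sqsubseteq> H}" if "G \<in> ?A" for G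
  proof -
    have "F \<sqsubseteq> H" if "H \<in> faces P k" "G \<sqsubseteq> H" for H
      using \<open>G \<in> ?A\<close> that F le_trans[of F G H] by (simp add: faces_def)
    then show ?thesis by blast
  qed
  then have "(\<Sum>G \<in> ?A. face_degree P k G) = (\<Sum>G \<in> ?A. card {H \<in> ?B. G \<sqsubseteq> H})"
    unfolding face_degree_def by (intro sum.cong) simp_all
  also have "\<dots> = (\<Sum>H \<in> ?B. card {G \<in> ?A. G \<sqsubseteq> H})"
    by (intro sum_card_swap) (simp_all add: finite_faces)
  also have "\<dots> = (\<Sum>H \<in> ?B. (k - rk P F) choose a)"
  proof (rule sum.cong)
    fix H assume H: "H \<in> ?B"
    have "{G \<in> ?A. G \<sqsubseteq> H} = {G \<in> carrier P. F \<sqsubseteq> G \<and> G \<sqsubseteq> H \<and> rk P G = rk P F + a}"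
      by (auto simp: faces_def)
    then show "card {G \<in> ?A. G \<sqsubseteq> H} = (k - rk P F) choose a"
      using card_interval_rank[of F H "rk P F + a"] F H by (simp add: faces_def)
  qed simp
  finally show ?thesis by (simp add: face_degree_def mult.commute)
qed

lemma chains_from_Cons:
  assumes F: "F \<in> carrier P" and a: "0 < a"
  shows "chains_from P (a # \<tau>) F
    = (\<Union>G \<in> {G \<in> faces P (rk P F + a). F \<sqsubseteq> G}. (#) G ` chains_from P \<tau> G)"
proof (intro equalityI subsetI)
  fix X assume X: "X \<in> chains_from P (a # \<tau>) F"
  then obtain G Y where XY: "X = G # Y" by (cases X) (auto simp: chains_from_def)
  have rkX: "\<And>j. j < Suc (length \<tau>) \<Longrightarrow> rk P (X ! j) = rk P F + sum_list (take (Suc j) (a # \<tau>))"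
    using X by (simp add: chains_from_def)
  have "rk P G = rk P F + a" using rkX[of 0] XY by simp
  moreover have "rk P (Y ! j) = rk P F + a + sum_list (take (Suc j) \<tau>)" if "j < length \<tau>" for j
    using rkX[of "Suc j"] that XY by simp
  ultimately show "X \<in> (\<Union>G \<in> {G \<in> faces P (rk P F + a). F \<sqsubseteq> G}. (#) G ` chains_from P \<tau> G)"
    using X XY by (auto simp: chains_from_def faces_def dest: lless_imp_le)
next
  fix X assume "X \<in> (\<Union>G \<in> {G \<in> faces P (rk P F + a). F \<sqsubseteq> G}. (#) G ` chains_from P \<tau> G)"
  then obtain G Y where G: "G \<in> carrier P" "rk P G = rk P F + a" "F \<sqsubseteq> G"
    and Y: "Y \<in> chains_from P \<tau> G" and X: "X = G # Y" by (auto simp: faces_def)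
  have FG: "F \<sqsubset> G" using G a by (auto simp: lless_eq)
  have "F \<sqsubset> y" if "y \<in> set Y" for y
    using lless_trans[OF FG, of y] that Y F G(1) by (auto simp: chains_from_def)
  moreover have "rk P (X ! j) = rk P F + sum_list (take (Suc j) (a # \<tau>))" if "j < length (a # \<tau>)" for j
    using that Y G(2) X by (cases j) (auto simp: chains_from_def)
  ultimately show "X \<in> chains_from P (a # \<tau>) F"
    using FG G(1) Y X unfolding chains_from_def by simp
qed

lemma finite_chains_from: "finite (chains_from P \<tau> F)"
  by (rule finite_subset[OF _ finite_lists_length_eq[OF finite_carrier, of "length \<tau>"]])
    (auto simp: chains_from_def)

lemma card_chains_from:
  assumes "F \<in> carrier P" "\<forall>a \<in> set \<tau>. 0 < a" "rk P F + sum_list \<tau> = k"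
  shows "card (chains_from P \<tau> F) = multinomial \<tau> * face_degree P k F"
  using assms
proof (induction \<tau> arbitrary: F)
  case Nil
  have "{H \<in> faces P k. F \<sqsubseteq> H} = {F}"
    using Nil by (auto simp: faces_def intro: eq_if_le_rk_eq[symmetric])
  moreover have "chains_from P [] F = {[]}" by (auto simp: chains_from_def)
  ultimately show ?case by (simp add: face_degree_def)
next
  case (Cons a \<tau>)
  let ?A = "{G \<in> faces P (rk P F + a). F \<sqsubseteq> G}"
  have "card (chains_from P (a # \<tau>) F) = (\<Sum>G \<in> ?A. card ((#) G ` chains_from P \<tau> G))"
    using Cons.prems
    by (subst chains_from_Cons)
      (auto intro!: card_UN_disjoint simp: finite_faces finite_chains_from)
  also have "\<dots> = (\<Sum>G \<in> ?A. multinomial \<tau> * face_degree P k G)"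
  proof (rule sum.cong)
    fix G assume "G \<in> ?A"
    then have "card (chains_from P \<tau> G) = multinomial \<tau> * face_degree P k G"
      using Cons.prems by (intro Cons.IH) (auto simp: faces_def)
    then show "card ((#) G ` chains_from P \<tau> G) = multinomial \<tau> * face_degree P k G"
      by (simp add: card_image)
  qed simp
  also have "\<dots> = multinomial \<tau> * (((k - rk P F) choose a) * face_degree P k F)"
    using sum_face_degree[OF Cons.prems(1), of a k] Cons.prems(3)
    by (simp add: sum_distrib_left[symmetric])
  also have "k - rk P F = a + sum_list \<tau>" using Cons.prems(3) by simp
  finally show ?case by simp
qed

lemma flag_degree_eq:
  assumes F: "F \<in> faces P s" and \<sigma>: "composition k (s # \<tau>)"
  shows "flag_degree P (s # \<tau>) F = multinomial \<tau> * face_degree P k F"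
proof -
  let ?S = "{X. length X = length (s # \<tau>) \<and> set X \<subseteq> carrier P \<and>
     hd X = F \<and> sorted_wrt (\<lambda>x y. x \<sqsubset> y) X \<and>
     (\<forall>j < length (s # \<tau>). rk P (X ! j) = sum_list (take (Suc j) (s # \<tau>)))}"
  have "?S = (#) F ` chains_from P \<tau> F"
  proof (intro equalityI subsetI)
    fix X assume X: "X \<in> ?S"
    then obtain Y where XY: "X = F # Y" by (cases X) auto
    have "rk P (Y ! j) = rk P F + sum_list (take (Suc j) \<tau>)" if "j < length \<tau>" for j
    proof -
      have "rk P (X ! Suc j) = sum_list (take (Suc (Suc j)) (s # \<tau>))"
        using X that by (auto simp del: take_Suc_Cons)
      then show ?thesis using XY F by (simp add: faces_def)
    qed
    then show "X \<in> (#) F ` chains_from P \<tau> F" using X XY by (auto simp: chains_from_def)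
  next
    fix X assume "X \<in> (#) F ` chains_from P \<tau> F"
    then obtain Y where Y: "Y \<in> chains_from P \<tau> F" and X: "X = F # Y" by blast
    have "rk P (X ! j) = sum_list (take (Suc j) (s # \<tau>))" if "j < length (s # \<tau>)" for j
      using that Y F X by (cases j) (auto simp: chains_from_def faces_def)
    then show "X \<in> ?S" using Y X F by (simp add: chains_from_def faces_def)
  qed
  then have "flag_degree P (s # \<tau>) F = card (chains_from P \<tau> F)"
    by (simp add: flag_degree_def card_image)
  also have "\<dots> = multinomial \<tau> * face_degree P k F"
    using F \<sigma> by (intro card_chains_from) (auto simp: faces_def composition_def)
  finally show ?thesis .
qed

lemma sum_flag_degree:
  assumes \<sigma>: "composition k (s # \<tau>)"
  shows "(\<Sum>F \<in> faces P s. flag_degree P (s # \<tau>) F) = multinomial (s # \<tau>) * card (faces P k)"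
proof -
  have k: "s + sum_list \<tau> = k" using \<sigma> by (simp add: composition_def)
  have "{G \<in> faces P n. \<bottom> \<sqsubseteq> G} = faces P n" for n by (auto simp: faces_def)
  then have "(\<Sum>F \<in> faces P s. face_degree P k F) = (k choose s) * card (faces P k)"
    using sum_face_degree[of \<bottom> s k] k by (simp add: rk_bottom face_degree_def)
  moreover have "(\<Sum>F \<in> faces P s. flag_degree P (s # \<tau>) F)
      = multinomial \<tau> * (\<Sum>F \<in> faces P s. face_degree P k F)"
    unfolding sum_distrib_left by (intro sum.cong flag_degree_eq \<sigma>) simp
  ultimately show ?thesis using k by simp
qed

end

section \<open>Sums of the largest terms\<close>

text \<open>
  The first \<open>r\<close> terms of the decreasingly sorted values of \<open>g\<close> are the values on a set \<open>T\<close>,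
  which is all of \<open>A\<close> if \<open>r\<close> exceeds the number of terms.
\<close>

lemma sum_take_sorted_eq:
  fixes g :: "'a \<Rightarrow> nat"
  assumes "finite A"
  shows "\<exists>T \<subseteq> A. card T = min r (card A) \<and>
    sum_list (take r (rev (sorted_list_of_multiset (image_mset g (mset_set A))))) = sum g T \<and>
    (\<forall>x \<in> T. \<forall>y \<in> A - T. g y \<le> g x)"
proof -
  obtain ys where ys: "set ys = A" "distinct ys" using finite_distinct_list[OF assms] by blast
  define xs where "xs = rev (sort_key g ys)"
  have xs: "set xs = A" "distinct xs" using ys by (simp_all add: xs_def)
  have sort_map: "sort (map g ys) = map g (sort_key g ys)" by (rule properties_for_sort) simp_all
  have "image_mset g (mset_set A) = mset (map g ys)" using ys by (simp add: mset_set_set[symmetric])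
  then have L: "rev (sorted_list_of_multiset (image_mset g (mset_set A))) = map g xs"
    by (simp add: xs_def rev_map[symmetric] sort_map del: mset_map)
  have dec: "g (xs ! j) \<le> g (xs ! i)" if "i \<le> j" "j < length xs" for i j
  proof -
    have "sorted (rev (map g xs))" by (simp add: xs_def rev_map[symmetric])
    then show ?thesis using that sorted_rev_nth_mono[of "map g xs" i j] by simp
  qed
  let ?T = "set (take r xs)"
  have "card ?T = min r (card A)"
    using xs distinct_card[OF xs(2)] distinct_card[of "take r xs"] by (simp add: min.commute)
  moreover have "sum_list (take r (map g xs)) = sum g ?T"
    using xs(2) by (simp add: take_map sum_list_distinct_conv_sum_set)
  moreover have "g y \<le> g x" if x: "x \<in> ?T" and y: "y \<in> A - ?T" for x y
  proof -
    obtain i where i: "i < r" "i < length xs" "x = xs ! i" using x by (auto simp: in_set_conv_nth)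
    obtain j where j: "j < length xs" "y = xs ! j" using y xs(1) by (auto simp: in_set_conv_nth)
    have "r \<le> j"
    proof (rule ccontr)
      assume "\<not> r \<le> j"
      then have "y \<in> ?T" using j by (auto simp: in_set_conv_nth intro!: exI[of _ j])
      then show False using y by simp
    qed
    then show ?thesis using dec[of i j] i j by simp
  qed
  moreover have "?T \<subseteq> A" using xs(1) set_take_subset by fast
  ultimately show ?thesis unfolding L by blast
qed

lemma weighted_sum_le_top_sum:
  fixes g x :: "'a \<Rightarrow> real"
  assumes fin: "finite A" and TA: "T \<subseteq> A" and card: "card T = min r (card A)"
    and top: "\<And>F G. F \<in> T \<Longrightarrow> G \<in> A - T \<Longrightarrow> g G \<le> g F"
    and nonneg: "\<And>F. F \<in> A \<Longrightarrow> 0 \<le> g F"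
    and x: "\<And>F. F \<in> A \<Longrightarrow> 0 \<le> x F" "\<And>F. F \<in> A \<Longrightarrow> x F \<le> 1"
    and sum: "(\<Sum>F\<in>A. x F) \<le> real r"
  shows "(\<Sum>F\<in>A. x F * g F) \<le> (\<Sum>F\<in>T. g F)"
proof (cases "T = A")
  case True
  then show ?thesis using x nonneg by (auto intro!: sum_mono mult_left_le_one_le)
next
  case False
  have r: "card T = r"
    using card False TA fin card_subset_eq[OF fin TA] by (auto simp: min_def split: if_splits)
  \<comment> \<open>The threshold \<open>c\<close> separates the values on \<open>T\<close> from those outside. Replacing \<open>g\<close> by
    \<open>c\<close> only increases the difference of the two sums.\<close>
  define c where "c = Max (g ` (A - T))"
  have ne: "g ` (A - T) \<noteq> {}" using False TA by blast
  have c_ge: "g G \<le> c" if "G \<in> A - T" for G using that fin by (simp add: c_def)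
  have c_in: "c \<in> g ` (A - T)" unfolding c_def using fin ne by (intro Max_in) auto
  then have c_le: "c \<le> g F" if "F \<in> T" for F using top that by auto
  have c0: "0 \<le> c" using c_in nonneg by auto
  have "(\<Sum>F\<in>A. x F * g F) - (\<Sum>F\<in>T. g F)
      = (\<Sum>F\<in>A-T. x F * g F) + (\<Sum>F\<in>T. (x F - 1) * g F)"
    using sum.subset_diff[OF TA fin, of "\<lambda>F. x F * g F"] by (simp add: left_diff_distrib sum_subtractf)
  also have "\<dots> \<le> (\<Sum>F\<in>A-T. x F * c) + (\<Sum>F\<in>T. (x F - 1) * c)"
    using x TA c_ge c_le
    by (intro add_mono sum_mono mult_left_mono mult_left_mono_neg) (auto simp: subset_iff)
  also have "\<dots> = c * ((\<Sum>F\<in>A. x F) - real (card T))"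
    using sum.subset_diff[OF TA fin, of x]
    by (simp add: sum_distrib_right[symmetric] sum_subtractf) (simp add: algebra_simps)
  also have "\<dots> \<le> 0" using c0 sum r by (simp add: mult_nonneg_nonpos)
  finally show ?thesis by simp
qed

section \<open>Fractional shadows\<close>

lemma binomial_mono_symmetric:
  assumes "s \<le> t" "s + t \<le> (k::nat)"
  shows "k choose s \<le> k choose t"
proof (cases "2 * t \<le> k")
  case True
  then show ?thesis using assms(1) by (intro binomial_mono)
next
  case False
  then have "k choose s \<le> k choose (k - t)" using assms by (intro binomial_mono) auto
  also have "\<dots> = k choose t" using assms by (intro binomial_symmetric[symmetric]) simp
  finally show ?thesis .
qed

context finite_simplicial_poset
begin

text \<open>
  A set \<open>S\<close> of rank-\<open>t\<close> faces has a fractional shadow on the rank-\<open>s\<close> faces which is no larger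
  than \<open>S\<close>, and whose number of incidences with rank-\<open>k\<close> faces, divided by \<open>k choose s\<close>, is at
  least that of \<open>S\<close>, divided by \<open>k choose t\<close>.
\<close>

lemma fractional_shadow:
  assumes st: "s \<le> t" "t \<le> k" and mono: "k choose s \<le> k choose t" and S: "S \<subseteq> faces P t"
  shows "\<exists>x :: 'a \<Rightarrow> real. (\<forall>F. 0 \<le> x F \<and> x F \<le> 1) \<and> (\<Sum>F \<in> faces P s. x F) \<le> real (card S) \<and>
    real (k choose s) * (\<Sum>G \<in> S. real (face_degree P k G))
      \<le> real (k choose t) * (\<Sum>F \<in> faces P s. x F * real (face_degree P k F))"
proof -
  define x :: "'a \<Rightarrow> real"
    where "x F = min 1 (real (card {G \<in> S. F \<sqsubseteq> G}) / real (t choose s))" for F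
  have finS: "finite S" using S finite_faces finite_subset by blast
  have S_faces: "G \<in> faces P t" if "G \<in> S" for G using S that by (rule subsetD)
  have ts: "0 < real (t choose s)" using st by simp
  have x01: "0 \<le> x F \<and> x F \<le> 1" for F by (simp add: x_def)
  have below: "card {F \<in> faces P s. F \<sqsubseteq> G} = t choose s" if "G \<in> faces P t" for G t
  proof -
    have "{F \<in> faces P s. F \<sqsubseteq> G} = {F \<in> carrier P. F \<sqsubseteq> G \<and> rk P F = s}" by (auto simp: faces_def)
    then show ?thesis using card_rank_below[of G s] that by (simp add: faces_def)
  qed

  have "(\<Sum>F \<in> faces P s. x F) \<le> (\<Sum>F \<in> faces P s. real (card {G \<in> S. F \<sqsubseteq> G}) / real (t choose s))"
    by (intro sum_mono) (simp add: x_def)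
  also have "\<dots> = real (\<Sum>F \<in> faces P s. card {G \<in> S. F \<sqsubseteq> G}) / real (t choose s)"
    by (simp add: sum_divide_distrib)
  also have "(\<Sum>F \<in> faces P s. card {G \<in> S. F \<sqsubseteq> G}) = (\<Sum>G \<in> S. card {F \<in> faces P s. F \<sqsubseteq> G})"
    by (intro sum_card_swap finite_faces finS)
  also have "\<dots> = (\<Sum>G \<in> S. t choose s)" using S by (intro sum.cong below) auto
  finally have sum_x: "(\<Sum>F \<in> faces P s. x F) \<le> real (card S)" using ts by simp

  \<comment> \<open>The required inequality, with \<open>face_degree\<close> replaced by the incidence with a single
    face \<open>H\<close> of rank \<open>k\<close>.\<close>
  have facet: "real (k choose s) * real (card {G \<in> S. G \<sqsubseteq> H})
      \<le> real (k choose t) * (\<Sum>F \<in> {F \<in> faces P s. F \<sqsubseteq> H}. x F)" if H: "H \<in> faces P k" for H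
  proof -
    let ?d = "\<lambda>F. card {G \<in> {G \<in> S. G \<sqsubseteq> H}. F \<sqsubseteq> G}"
    \<comment> \<open>Only the members of \<open>S\<close> below \<open>H\<close> are counted by \<open>?d\<close>, while the weight \<open>x\<close> counts
      all of \<open>S\<close>.\<close>
    have pointwise: "real (k choose s) * real (?d F) \<le> real (k choose t) * real (t choose s) * x F"
      if F: "F \<in> faces P s" "F \<sqsubseteq> H" for F
    proof (cases "real (card {G \<in> S. F \<sqsubseteq> G}) / real (t choose s) \<le> 1")
      case True
      have "?d F \<le> card {G \<in> S. F \<sqsubseteq> G}" using finS by (intro card_mono) auto
      then have "(k choose s) * ?d F \<le> (k choose t) * card {G \<in> S. F \<sqsubseteq> G}"
        using mono by (intro mult_le_mono)
      then have "real (k choose s) * real (?d F) \<le> real (k choose t) * real (card {G \<in> S. F \<sqsubseteq> G})"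
        by (simp only: of_nat_mult[symmetric] of_nat_le_iff)
      then show ?thesis using True ts by (simp add: x_def min_def)
    next
      case False
      \<comment> \<open>The weight is truncated to 1, which suffices since \<open>F\<close> lies below at most
        \<open>(k - s) choose (t - s)\<close> rank-\<open>t\<close> faces of \<open>[\<bottom>, H]\<close>.\<close>
      have "?d F \<le> card {G \<in> carrier P. F \<sqsubseteq> G \<and> G \<sqsubseteq> H \<and> rk P G = t}"
        using S_faces finite_carrier by (intro card_mono) (auto simp: faces_def)
      also have "\<dots> = (k - s) choose (t - s)"
        using card_interval_rank[of F H t] F H st by (simp add: faces_def)
      finally have "(k choose s) * ?d F \<le> (k choose s) * ((k - s) choose (t - s))" by simp
      also have "\<dots> = (k choose t) * (t choose s)" using choose_mult[OF st] by simp
      finally have "real (k choose s) * real (?d F) \<le> real (k choose t) * real (t choose s)"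
        by (simp only: of_nat_mult[symmetric] of_nat_le_iff)
      then show ?thesis using False by (simp add: x_def min_def)
    qed
    have "(\<Sum>F \<in> {F \<in> faces P s. F \<sqsubseteq> H}. ?d F)
        = (\<Sum>G \<in> {G \<in> S. G \<sqsubseteq> H}. card {F \<in> {F \<in> faces P s. F \<sqsubseteq> H}. F \<sqsubseteq> G})"
      by (intro sum_card_swap) (simp_all add: finite_faces finS)
    also have "\<dots> = (\<Sum>G \<in> {G \<in> S. G \<sqsubseteq> H}. t choose s)"
    proof (rule sum.cong)
      fix G assume G: "G \<in> {G \<in> S. G \<sqsubseteq> H}"
      have "F \<sqsubseteq> H" if "F \<in> faces P s" "F \<sqsubseteq> G" for F
        using that G H S_faces[of G] le_trans[of F G H] by (simp add: faces_def)
      then have "{F \<in> {F \<in> faces P s. F \<sqsubseteq> H}. F \<sqsubseteq> G} = {F \<in> faces P s. F \<sqsubseteq> G}" by blast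
      then show "card {F \<in> {F \<in> faces P s. F \<sqsubseteq> H}. F \<sqsubseteq> G} = t choose s"
        using below[of G t] G S_faces[of G] by simp
    qed simp
    finally have d_sum: "(\<Sum>F \<in> {F \<in> faces P s. F \<sqsubseteq> H}. ?d F) = (t choose s) * card {G \<in> S. G \<sqsubseteq> H}"
      by simp
    have "real (t choose s) * (real (k choose s) * real (card {G \<in> S. G \<sqsubseteq> H}))
        = real (k choose s) * real (\<Sum>F \<in> {F \<in> faces P s. F \<sqsubseteq> H}. ?d F)"
      unfolding d_sum by simp
    also have "\<dots> = (\<Sum>F \<in> {F \<in> faces P s. F \<sqsubseteq> H}. real (k choose s) * real (?d F))"
      by (simp add: sum_distrib_left)
    also have "\<dots> \<le> (\<Sum>F \<in> {F \<in> faces P s. F \<sqsubseteq> H}. real (k choose t) * real (t choose s) * x F)"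
      using pointwise by (intro sum_mono) simp
    also have "\<dots> = real (t choose s) * (real (k choose t) * (\<Sum>F \<in> {F \<in> faces P s. F \<sqsubseteq> H}. x F))"
      by (simp add: sum_distrib_left mult_ac)
    finally show ?thesis using ts by (simp only: mult_le_cancel_left_pos)
  qed

  have "(\<Sum>G \<in> S. real (face_degree P k G)) = real (\<Sum>H \<in> faces P k. card {G \<in> S. G \<sqsubseteq> H})"
    using sum_card_swap[OF finite_faces finS, of "\<lambda>H G. G \<sqsubseteq> H" k]
    by (simp add: face_degree_def flip: of_nat_sum)
  then have "real (k choose s) * (\<Sum>G \<in> S. real (face_degree P k G))
      = (\<Sum>H \<in> faces P k. real (k choose s) * real (card {G \<in> S. G \<sqsubseteq> H}))"
    by (simp add: sum_distrib_left)
  also have "\<dots> \<le> (\<Sum>H \<in> faces P k. real (k choose t) * (\<Sum>F \<in> {F \<in> faces P s. F \<sqsubseteq> H}. x F))"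
    using facet by (intro sum_mono)
  also have "\<dots> = real (k choose t) * (\<Sum>H \<in> faces P k. \<Sum>F \<in> {F \<in> faces P s. F \<sqsubseteq> H}. x F)"
    by (simp add: sum_distrib_left)
  also have "(\<Sum>H \<in> faces P k. \<Sum>F \<in> {F \<in> faces P s. F \<sqsubseteq> H}. x F)
      = (\<Sum>F \<in> faces P s. \<Sum>H \<in> {H \<in> faces P k. F \<sqsubseteq> H}. x F)"
    by (rule sum.swap_restrict[OF finite_faces finite_faces])
  also have "\<dots> = (\<Sum>F \<in> faces P s. x F * real (face_degree P k F))"
    by (simp add: face_degree_def mult.commute)
  finally show ?thesis using x01 sum_x by blast
qed

end

section \<open>Majorization of flag degree sequences\<close>

lemma sum_list_flag_degree_seq:
  "sum_list (flag_degree_seq P \<sigma>) = (\<Sum>F \<in> faces P (hd \<sigma>). flag_degree P \<sigma> F)"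
proof -
  have "sum_list (flag_degree_seq P \<sigma>) = sum_mset (mset (flag_degree_seq P \<sigma>))"
    by (simp only: sum_mset_sum_list)
  then show ?thesis by (simp add: flag_degree_seq_def faces_def sum_unfold_sum_mset)
qed

lemma (in finite_simplicial_poset) top_flag_degrees_le:
  assumes \<sigma>: "composition k (s # \<tau>)" and \<pi>: "mset (t # \<rho>) = mset (s # \<tau>)" and st: "s \<le> t"
  shows "sum_list (take r (flag_degree_seq P (t # \<rho>))) \<le> sum_list (take r (flag_degree_seq P (s # \<tau>)))"
proof -
  let ?D\<sigma> = "flag_degree P (s # \<tau>)" and ?D\<pi> = "flag_degree P (t # \<rho>)"
  have sums: "s + sum_list \<tau> = k" "t + sum_list \<rho> = k"
    using \<sigma> arg_cong[OF \<pi>, of sum_mset] by (simp_all add: composition_def sum_mset_sum_list)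
  have \<pi>c: "composition k (t # \<rho>)"
    using \<sigma> sums mset_eq_setD[OF \<pi>] unfolding composition_def by simp
  have choose_le: "k choose s \<le> k choose t"
  proof (cases "s = t")
    case False
    then have "t \<in> set \<tau>" using mset_eq_setD[OF \<pi>] by auto
    then have "s + t \<le> k" using member_le_sum_list[of t \<tau>] sums by simp
    then show ?thesis using st by (rule binomial_mono_symmetric[rotated])
  qed simp
  have pos: "0 < real (k choose s)" "0 < real (k choose t)" using sums by simp_all
  have mult: "real (k choose s) * real (multinomial \<tau>) = real (k choose t) * real (multinomial \<rho>)"
    using multinomial_mset_cong[OF \<pi>] sums by (simp flip: of_nat_mult)

  obtain S where S: "S \<subseteq> faces P t" "card S = min r (card (faces P t))"
    "sum_list (take r (flag_degree_seq P (t # \<rho>))) = sum ?D\<pi> S"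
    using sum_take_sorted_eq[OF finite_faces, of t r ?D\<pi>]
    unfolding flag_degree_seq_def faces_def[symmetric] by auto
  obtain T where T: "T \<subseteq> faces P s" "card T = min r (card (faces P s))"
    "sum_list (take r (flag_degree_seq P (s # \<tau>))) = sum ?D\<sigma> T"
    "\<forall>F \<in> T. \<forall>G \<in> faces P s - T. ?D\<sigma> G \<le> ?D\<sigma> F"
    using sum_take_sorted_eq[OF finite_faces, of s r ?D\<sigma>]
    unfolding flag_degree_seq_def faces_def[symmetric] by auto
  obtain x :: "'a \<Rightarrow> real" where x: "\<And>F. 0 \<le> x F" "\<And>F. x F \<le> 1"
      "(\<Sum>F \<in> faces P s. x F) \<le> real (card S)"
      "real (k choose s) * (\<Sum>G \<in> S. real (face_degree P k G))
        \<le> real (k choose t) * (\<Sum>F \<in> faces P s. x F * real (face_degree P k F))"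
    using fractional_shadow[OF st _ choose_le S(1)] sums by auto

  have "(\<Sum>G \<in> S. real (?D\<pi> G)) = real (multinomial \<rho>) * (\<Sum>G \<in> S. real (face_degree P k G))"
    unfolding sum_distrib_left using S(1) by (intro sum.cong) (auto simp: flag_degree_eq[OF _ \<pi>c])
  then have "real (k choose s) * real (k choose t) * (\<Sum>G \<in> S. real (?D\<pi> G))
      = real (k choose t) * real (multinomial \<rho>) * (real (k choose s) * (\<Sum>G \<in> S. real (face_degree P k G)))"
    by (simp add: mult_ac)
  also have "\<dots> \<le> real (k choose t) * real (multinomial \<rho>)
      * (real (k choose t) * (\<Sum>F \<in> faces P s. x F * real (face_degree P k F)))"
    using x(4) by (intro mult_left_mono) simp_all
  also have "\<dots> = real (k choose s) * real (k choose t)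
      * (real (multinomial \<tau>) * (\<Sum>F \<in> faces P s. x F * real (face_degree P k F)))"
    unfolding mult[symmetric] by (simp add: mult_ac)
  also have "real (multinomial \<tau>) * (\<Sum>F \<in> faces P s. x F * real (face_degree P k F))
      = (\<Sum>F \<in> faces P s. x F * real (?D\<sigma> F))"
    unfolding sum_distrib_left by (intro sum.cong) (simp_all add: flag_degree_eq[OF _ \<sigma>] mult_ac)
  finally have "(\<Sum>G \<in> S. real (?D\<pi> G)) \<le> (\<Sum>F \<in> faces P s. x F * real (?D\<sigma> F))"
    using pos by (simp only: mult_le_cancel_left_pos mult_pos_pos)
  also have "\<dots> \<le> (\<Sum>F \<in> T. real (?D\<sigma> F))"
    using T(4) x S(2) by (intro weighted_sum_le_top_sum[OF finite_faces T(1,2)]) auto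
  finally show ?thesis using S(3) T(3) by (simp flip: of_nat_sum)
qed

theorem theorem3p5:
  fixes P :: "('a, 'b) gorder_scheme"
    and k :: nat
    and \<sigma> \<pi> :: "nat list"
  assumes "simplicial_poset P"
    and "finite (carrier P)"
    and "pure_of_rank P k"
    and "composition k \<sigma>"
    and "mset \<pi> = mset \<sigma>"
    and "hd \<sigma> \<le> hd \<pi>"
  shows "flag_degree_seq P \<sigma> \<unrhd> flag_degree_seq P \<pi>"
proof (cases \<sigma>)
  \<comment> \<open>Here \<open>hd \<sigma>\<close> is unspecified, but both compositions are empty and hence equal.\<close>
  case Nil
  then show ?thesis using assms(5) by (simp add: majorizes_def)
next
  case (Cons s \<tau>)
  then obtain t \<rho> where \<pi>: "\<pi> = t # \<rho>" using assms(5) by (cases \<pi>) auto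
  interpret finite_simplicial_poset P
    using assms(1,2) by (simp add: finite_simplicial_poset_def finite_simplicial_poset_axioms_def)
  have "composition k \<pi>"
    using assms(4,5) mset_eq_setD[OF assms(5)] unfolding composition_def
    by (metis sum_mset_sum_list)
  then have "sum_list (flag_degree_seq P \<sigma>) = sum_list (flag_degree_seq P \<pi>)"
    using sum_flag_degree[of k s \<tau>] sum_flag_degree[of k t \<rho>] multinomial_mset_cong[OF assms(5)]
      assms(4) Cons \<pi> by (simp add: sum_list_flag_degree_seq)
  moreover have "sum_list (take r (flag_degree_seq P \<pi>)) \<le> sum_list (take r (flag_degree_seq P \<sigma>))" for r
    using top_flag_degrees_le[of k s \<tau> t \<rho> r] assms(4-6) Cons \<pi> by simp
  ultimately show ?thesis by (simp add: majorizes_def)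
qed

end
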